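(* Let $L$ be a spatial frame which is also a coframe. The following are equivalent. (1) The space $\mathsf{pt}(L)$ is $T_D$. (2) All primes of $L$ are completely prime. (3) The space $\mathsf{pt}(L)$ is scattered.
   Context: For a frame $L$, a prime is an element $p\neq 1$ such that $x\wedge y\leq p$ implies $x\leq p$ or $y\leq p$. $\mathsf{pt}(L)$ is the set of primes of $L$, topologized with open sets $\{p\in\mathsf{pt}(L): a\nleq p\}$, $a\in L$. A frame is spatial if every element is a meet of primes. A complete lattice is a coframe if finite joins distribute over arbitrary meets. An element $a\in L$ is completely prime if for every $A\subseteq L$, $\bigwedge A\leq a$ implies $x\leq a$ for some $x\in A$. A space $X$ is $T_D$ if every $x\in X$ has an open neighborhood $U$ with $U\setminus\{x\}$ open. A space is scattered if every nonempty subspace has an isolated point (isolated in that subspace). *)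

theory Defs
  imports "HOL-Analysis.Abstract_Topology"
begin

text \<open>The library class \<^class>\<open>complete_distrib_lattice\<close> demands complete distributivity,
  which is stronger than being a frame and a coframe at the same time; hence the two classes below.\<close>

class frame = complete_lattice +
  assumes inf_Sup_distrib: "inf a (Sup B) = (SUP b\<in>B. inf a b)"

class coframe = complete_lattice +
  assumes sup_Inf_distrib: "sup a (Inf B) = (INF b\<in>B. sup a b)"

definition lattice_prime :: "'a::complete_lattice \<Rightarrow> bool"
  where "lattice_prime p \<longleftrightarrow>
    p \<noteq> top \<and> (\<forall>x y. inf x y \<le> p \<longrightarrow> x \<le> p \<or> y \<le> p)"

definition completely_prime :: "'a::complete_lattice \<Rightarrow> bool"
  where "completely_prime a \<longleftrightarrow> (\<forall>A. Inf A \<le> a \<longrightarrow> (\<exists>x\<in>A. x \<le> a))"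

definition spatial :: "'a::complete_lattice itself \<Rightarrow> bool"
  where "spatial _ \<longleftrightarrow> (\<forall>a::'a. \<exists>P. (\<forall>p\<in>P. lattice_prime p) \<and> a = Inf P)"

definition pt :: "'a::complete_lattice topology"
  where "pt = topology (\<lambda>U. \<exists>a. U = {p. lattice_prime p \<and> \<not> a \<le> p})"

lemma openin_pt:
  "openin (pt :: 'a::complete_lattice topology) U \<longleftrightarrow>
    (\<exists>a. U = {p. lattice_prime p \<and> \<not> a \<le> p})"
proof -
  let ?O = "\<lambda>a::'a. {p. lattice_prime p \<and> \<not> a \<le> p}"
  have "istopology (\<lambda>U. \<exists>a. U = ?O a)"
    unfolding istopology_def
  proof (intro conjI allI impI)
    fix S T assume "\<exists>a. S = ?O a" "\<exists>a. T = ?O a"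
    then obtain a b where ab: "S = ?O a" "T = ?O b" by blast
    have "S \<inter> T = ?O (inf a b)"
    proof (rule set_eqI)
      fix p
      have "inf a b \<le> p \<longleftrightarrow> a \<le> p \<or> b \<le> p" if "lattice_prime p"
        using that le_infI1 le_infI2 unfolding lattice_prime_def by metis
      then show "p \<in> S \<inter> T \<longleftrightarrow> p \<in> ?O (inf a b)"
        unfolding ab by blast
    qed
    then show "\<exists>a. S \<inter> T = ?O a" by blast
  next
    fix K assume K: "\<forall>S\<in>K. \<exists>a. S = ?O a"
    then obtain f where f: "\<And>S. S \<in> K \<Longrightarrow> S = ?O (f S)" by metis
    have "\<Union>K = (\<Union>S\<in>K. ?O (f S))"
      using f by (simp cong: SUP_cong)
    also have "\<dots> = ?O (SUP S\<in>K. f S)"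
      by (auto simp: SUP_le_iff)
    finally show "\<exists>a. \<Union>K = ?O a" by (rule exI)
  qed
  then show ?thesis
    by (simp add: pt_def)
qed

lemma topspace_pt: "topspace (pt :: 'a::complete_lattice topology) = {p. lattice_prime p}"
proof
  show "topspace (pt :: 'a topology) \<subseteq> {p. lattice_prime p}"
    unfolding topspace_def openin_pt by auto
  have "{p::'a. lattice_prime p} = {p. lattice_prime p \<and> \<not> top \<le> p}"
    by (simp add: lattice_prime_def top_unique cong: conj_cong)
  then have "openin pt {p::'a. lattice_prime p}"
    unfolding openin_pt by (rule exI)
  then show "{p::'a. lattice_prime p} \<subseteq> topspace pt"
    by (rule openin_subset)
qed

definition T_D_space :: "'a topology \<Rightarrow> bool"
  where "T_D_space X \<longleftrightarrow>
    (\<forall>x\<in>topspace X. \<exists>U. openin X U \<and> x \<in> U \<and> openin X (U - {x}))"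

definition scattered_space :: "'a topology \<Rightarrow> bool"
  where "scattered_space X \<longleftrightarrow>
    (\<forall>S. S \<subseteq> topspace X \<and> S \<noteq> {} \<longrightarrow> (\<exists>x\<in>S. openin (subtopology X S) {x}))"

end

theory Submission
  imports Defs
begin

text \<open>
  Points of \<^const>\<open>pt\<close> are primes, and the closure of the point \<open>p\<close> consists of the primes above
  \<open>p\<close>. Under the hypotheses, all three conditions say, in different ways, that a prime can be
  separated by a single element from what lies strictly above it.

  \<^item> \<open>p\<close> has a \<open>T\<^sub>D\<close> neighbourhood iff some element \<open>a\<close> with \<open>\<not> a \<le> p\<close> lies below every prime strictly
    above \<open>p\<close>: the neighbourhood \<open>{q. \<not> a \<le> q}\<close> then meets the closure of \<open>p\<close> only in \<open>p\<close>
    (\<open>T_D_space_pt_iff\<close>).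
  \<^item> If \<open>p\<close> is completely prime, the meet of all elements that are not below \<open>p\<close> is such an \<open>a\<close>.
    Conversely, given \<open>a\<close> and elements \<open>x \<in> A\<close> none of which is below \<open>p\<close>, spatiality writes each
    \<open>sup p x\<close> as a meet of primes strictly above \<open>p\<close>, so \<open>a \<le> sup p x\<close>; the coframe law turns this
    into \<open>a \<le> sup p (Inf A)\<close>, which rules out \<open>Inf A \<le> p\<close>
    (\<open>completely_prime_if_separated_from_above\<close>).
  \<^item> If the space is scattered, an isolated point of the closure of \<open>p\<close> must be \<open>p\<close> itself, because
    \<open>p\<close> is dense there; this yields \<open>a\<close>.
  \<^item> If all primes are completely prime, a minimal element \<open>p\<close> of a set \<open>S\<close> of primes is isolated in
    \<open>S\<close>, since \<open>Inf (S - {p}) \<le> p\<close> would put some other element of \<open>S\<close> below \<open>p\<close>. Minimal elements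
    exist because the meet of a chain of primes is prime, and a completely prime meet is attained:
    the primes satisfy the descending chain condition (\<open>minimal_prime_exists\<close>).
\<close>

text \<open>The neighbourhood determined by \<open>a\<close> loses exactly the point \<open>p\<close> when it is intersected with the
  open complement \<open>{q. \<not> p \<le> q}\<close> of the closure of \<open>p\<close>. Conversely, an open set without \<open>p\<close> is
  given by some \<open>b \<le> p\<close>, so it contains nothing above \<open>p\<close> either.\<close>

lemma T_D_space_pt_iff:
  "T_D_space (pt :: 'a::complete_lattice topology) \<longleftrightarrow>
    (\<forall>p::'a. lattice_prime p \<longrightarrow> (\<exists>a. \<not> a \<le> p \<and> (\<forall>q. lattice_prime q \<longrightarrow> p < q \<longrightarrow> a \<le> q)))"
    (is "_ \<longleftrightarrow> ?sep")
proof
  assume T_D: "T_D_space (pt :: 'a topology)"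
  show ?sep
  proof (intro allI impI)
    fix p :: 'a
    assume p: "lattice_prime p"
    then obtain U where "openin pt U" "p \<in> U" "openin pt (U - {p})"
      using T_D unfolding T_D_space_def topspace_pt by blast
    then obtain a b where a: "p \<in> {q. lattice_prime q \<and> \<not> a \<le> q}"
      and b: "{q. lattice_prime q \<and> \<not> a \<le> q} - {p} = {q. lattice_prime q \<and> \<not> b \<le> q}"
      unfolding openin_pt by auto
    have "b \<le> p"
      using b p by blast
    have "a \<le> q" if "lattice_prime q" "p < q" for q
    proof -
      have "b \<le> q"
        using \<open>b \<le> p\<close> less_imp_le[OF \<open>p < q\<close>] by (rule order_trans)
      then show ?thesis
        using b that by blast
    qed
    then show "\<exists>a. \<not> a \<le> p \<and> (\<forall>q. lattice_prime q \<longrightarrow> p < q \<longrightarrow> a \<le> q)"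
      using a by blast
  qed
next
  assume sep: ?sep
  show "T_D_space (pt :: 'a topology)"
    unfolding T_D_space_def topspace_pt
  proof
    fix p :: 'a
    assume "p \<in> {p. lattice_prime p}"
    then have p: "lattice_prime p" by simp
    with sep obtain a where a: "\<not> a \<le> p" "\<And>q. lattice_prime q \<Longrightarrow> p < q \<Longrightarrow> a \<le> q"
      by blast
    let ?U = "{q. lattice_prime q \<and> \<not> a \<le> q}"
    have open_a: "openin pt ?U" and "openin pt {q. lattice_prime q \<and> \<not> p \<le> q}"
      unfolding openin_pt by blast+
    then have "openin pt (?U \<inter> {q. lattice_prime q \<and> \<not> p \<le> q})"
      by (rule openin_Int)
    also have "?U \<inter> {q. lattice_prime q \<and> \<not> p \<le> q} = ?U - {p}"
      using a by (auto simp: order.order_iff_strict)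
    finally show "\<exists>U. openin pt U \<and> p \<in> U \<and> openin pt (U - {p})"
      using open_a p a(1) by blast
  qed
qed

lemma completely_prime_separated_from_above:
  fixes p :: "'a::complete_lattice"
  assumes "completely_prime p"
  shows "\<exists>a. \<not> a \<le> p \<and> (\<forall>q. p < q \<longrightarrow> a \<le> q)"
proof (intro exI conjI allI impI)
  show "\<not> Inf {x. \<not> x \<le> p} \<le> p"
    using assms unfolding completely_prime_def by blast
  show "Inf {x. \<not> x \<le> p} \<le> q" if "p < q" for q
    using that by (intro Inf_lower) (simp add: less_le_not_le)
qed

text \<open>Spatiality extends the separation of \<open>p\<close> from the primes strictly above it to all elements
  strictly above it, and such elements \<open>sup p x\<close> are controlled by the coframe law.\<close>

lemma completely_prime_if_separated_from_above:
  fixes p a :: "'a::coframe"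
  assumes spatial: "spatial TYPE('a)"
    and a: "\<not> a \<le> p" "\<And>q. lattice_prime q \<Longrightarrow> p < q \<Longrightarrow> a \<le> q"
  shows "completely_prime p"
  unfolding completely_prime_def
proof (intro allI impI, rule ccontr)
  fix A
  assume "Inf A \<le> p" and none: "\<not> (\<exists>x\<in>A. x \<le> p)"
  have "a \<le> sup p x" if "x \<in> A" for x
  proof -
    have "\<not> x \<le> p"
      using none that by blast
    then have "p < sup p x"
      by (simp add: less_le_not_le)
    obtain P where P: "\<forall>q\<in>P. lattice_prime q" "sup p x = Inf P"
      using spatial unfolding spatial_def by blast
    have "a \<le> q" if "q \<in> P" for q
    proof -
      have "sup p x \<le> q"
        unfolding P(2) using that by (rule Inf_lower)
      then show ?thesis
        using a(2)[of q] less_le_trans[OF \<open>p < sup p x\<close>] P(1) that by blast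
    qed
    then show ?thesis
      unfolding P(2) by (rule Inf_greatest)
  qed
  then have "a \<le> sup p (Inf A)"
    unfolding sup_Inf_distrib by (rule INF_greatest)
  also have "\<dots> = p"
    using \<open>Inf A \<le> p\<close> by (rule sup_absorb1)
  finally show False
    using a(1) by blast
qed

lemma lattice_prime_Inf_chain:
  fixes C :: "'a::complete_lattice set"
  assumes "C \<noteq> {}" and primes: "\<And>c. c \<in> C \<Longrightarrow> lattice_prime c"
    and chain: "\<And>c d. c \<in> C \<Longrightarrow> d \<in> C \<Longrightarrow> c \<le> d \<or> d \<le> c"
  shows "lattice_prime (Inf C)"
  unfolding lattice_prime_def
proof (intro conjI allI impI)
  obtain c where "c \<in> C"
    using \<open>C \<noteq> {}\<close> by blast
  then show "Inf C \<noteq> top"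
    using primes[of c] Inf_lower[of c C] by (auto simp: lattice_prime_def top_unique)
next
  fix x y
  assume xy: "inf x y \<le> Inf C"
  show "x \<le> Inf C \<or> y \<le> Inf C"
  proof (rule ccontr)
    assume "\<not> (x \<le> Inf C \<or> y \<le> Inf C)"
    then obtain c d where cd: "c \<in> C" "d \<in> C" "\<not> x \<le> c" "\<not> y \<le> d"
      by (auto simp: le_Inf_iff)
    \<comment> \<open>The smaller of \<open>c\<close> and \<open>d\<close> witnesses both failures at once, against its primality.\<close>
    then obtain e where e: "e \<in> C" "\<not> x \<le> e" "\<not> y \<le> e"
      using chain[OF cd(1,2)] order_trans[of x d c] order_trans[of y c d] by blast
    have "inf x y \<le> e"
      using xy Inf_lower[OF e(1)] by (rule order_trans)
    then show False
      using primes[OF e(1)] e(2,3) unfolding lattice_prime_def by blast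
  qed
qed

text \<open>By Zorn's lemma for the reversed order it suffices to bound a chain in \<open>S\<close> from below inside
  \<open>S\<close>. The meet of the chain is prime, hence completely prime, hence itself a member of the chain.\<close>

lemma minimal_prime_exists:
  fixes S :: "'a::complete_lattice set"
  assumes cp: "\<And>p::'a. lattice_prime p \<Longrightarrow> completely_prime p"
    and primes: "\<And>p. p \<in> S \<Longrightarrow> lattice_prime p" and "S \<noteq> {}"
  shows "\<exists>p\<in>S. \<forall>q\<in>S. q \<le> p \<longrightarrow> q = p"
proof (rule predicate_Zorn)
  show "partial_order_on S (relation_of (\<lambda>x y. y \<le> x) S)"
    by (rule partial_order_on_relation_ofI) auto
next
  fix C
  assume C: "C \<in> Chains (relation_of (\<lambda>x y. y \<le> x) S)"
  then have "C \<subseteq> S" and chain: "\<And>c d. c \<in> C \<Longrightarrow> d \<in> C \<Longrightarrow> c \<le> d \<or> d \<le> c"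
    by (auto simp: Chains_def relation_of_def)
  show "\<exists>u\<in>S. \<forall>c\<in>C. u \<le> c"
  proof (cases "C = {}")
    case True
    then show ?thesis
      using \<open>S \<noteq> {}\<close> by blast
  next
    case False
    then have "completely_prime (Inf C)"
      using \<open>C \<subseteq> S\<close> primes chain by (intro cp lattice_prime_Inf_chain) auto
    then obtain u where "u \<in> C" "u \<le> Inf C"
      unfolding completely_prime_def by blast
    then show ?thesis
      using \<open>C \<subseteq> S\<close> by (auto simp: le_Inf_iff)
  qed
qed

lemma scattered_space_pt_if_completely_prime:
  assumes cp: "\<And>p::'a::complete_lattice. lattice_prime p \<Longrightarrow> completely_prime p"
  shows "scattered_space (pt :: 'a topology)"
  unfolding scattered_space_def topspace_pt
proof (intro allI impI, elim conjE)
  fix S :: "'a set"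
  assume S: "S \<subseteq> {p. lattice_prime p}" "S \<noteq> {}"
  then obtain p where p: "p \<in> S" and minimal: "\<And>q. q \<in> S \<Longrightarrow> q \<le> p \<Longrightarrow> q = p"
    using minimal_prime_exists[of S, OF cp] by blast
  have "completely_prime p"
    using p S by (intro cp) blast
  then have "\<not> Inf (S - {p}) \<le> p"
    using minimal unfolding completely_prime_def by blast
  then have "{p} = {q. lattice_prime q \<and> \<not> Inf (S - {p}) \<le> q} \<inter> S"
    using p S Inf_lower[of _ "S - {p}"] by blast
  then have "openin (subtopology pt S) {p}"
    unfolding openin_subtopology openin_pt by blast
  with p show "\<exists>x\<in>S. openin (subtopology pt S) {x}"
    by blast
qed

lemma separated_from_above_if_scattered_space_pt:
  fixes p :: "'a::complete_lattice"
  assumes scattered: "scattered_space (pt :: 'a topology)" and p: "lattice_prime p"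
  shows "\<exists>a. \<not> a \<le> p \<and> (\<forall>q. lattice_prime q \<longrightarrow> p < q \<longrightarrow> a \<le> q)"
proof -
  let ?S = "{q. lattice_prime q \<and> p \<le> q}"
  have "?S \<subseteq> topspace pt" "?S \<noteq> {}"
    using p by (auto simp: topspace_pt)
  then obtain y where "openin (subtopology pt ?S) {y}"
    using scattered unfolding scattered_space_def by blast
  then obtain a where a: "{y} = {q. lattice_prime q \<and> \<not> a \<le> q} \<inter> ?S"
    unfolding openin_subtopology openin_pt by blast
  \<comment> \<open>Open sets of primes are downward closed, so every isolated point of \<open>?S\<close> equals its least
    element \<open>p\<close>.\<close>
  have "\<not> a \<le> p"
  proof -
    have "\<not> a \<le> y" "p \<le> y"
      using a by blast+
    then show ?thesis
      using order_trans by blast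
  qed
  then have "p \<in> {y}"
    unfolding a using p by simp
  then have "y = p"
    by simp
  show ?thesis
  proof (intro exI conjI allI impI)
    fix q
    assume "lattice_prime q" "p < q"
    then have "q \<noteq> y" "q \<in> ?S"
      using \<open>y = p\<close> by auto
    moreover have "q \<in> {y}" if "\<not> a \<le> q"
      unfolding a using that \<open>lattice_prime q\<close> \<open>q \<in> ?S\<close> by simp
    ultimately show "a \<le> q"
      by blast
  qed (fact \<open>\<not> a \<le> p\<close>)
qed

theorem proposition5p35:
  assumes "spatial TYPE('a::{frame, coframe})"
  shows "(T_D_space (pt :: 'a topology) \<longleftrightarrow> (\<forall>p::'a. lattice_prime p \<longrightarrow> completely_prime p)) \<and>
    ((\<forall>p::'a. lattice_prime p \<longrightarrow> completely_prime p) \<longleftrightarrow> scattered_space (pt :: 'a topology))"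
proof -
  let ?cp = "\<forall>p::'a. lattice_prime p \<longrightarrow> completely_prime p"
  let ?sep = "\<forall>p::'a. lattice_prime p \<longrightarrow>
    (\<exists>a. \<not> a \<le> p \<and> (\<forall>q. lattice_prime q \<longrightarrow> p < q \<longrightarrow> a \<le> q))"
  have "?cp" if sep: ?sep
  proof (intro allI impI)
    fix p :: 'a
    assume "lattice_prime p"
    then obtain a where "\<not> a \<le> p" "\<And>q. lattice_prime q \<Longrightarrow> p < q \<Longrightarrow> a \<le> q"
      using sep by blast
    then show "completely_prime p"
      by (rule completely_prime_if_separated_from_above[OF assms])
  qed
  moreover have "?sep" if cp: ?cp
  proof (intro allI impI)
    fix p :: 'a
    assume "lattice_prime p"
    then have "completely_prime p"
      using cp by blast
    from completely_prime_separated_from_above[OF this]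
    show "\<exists>a. \<not> a \<le> p \<and> (\<forall>q. lattice_prime q \<longrightarrow> p < q \<longrightarrow> a \<le> q)"
      by blast
  qed
  moreover have "?cp \<Longrightarrow> scattered_space (pt :: 'a topology)"
    by (intro scattered_space_pt_if_completely_prime) blast
  moreover have "scattered_space (pt :: 'a topology) \<Longrightarrow> ?sep"
    by (intro allI impI separated_from_above_if_scattered_space_pt)
  ultimately show ?thesis
    unfolding T_D_space_pt_iff by argo
qed

end
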